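(* There exists a constant $c>0$ such that for every positive integer $n$, $f_3(n)\geq c\cdot 1.4977^n$.
   Context: A hypergraph $\mathcal H$ is a pair $(V,\mathcal E)$ where $V$ is a finite set of vertices and $\mathcal E$ is a family of subsets of $V$ (edges), with $V=\bigcup\mathcal E$; its order is $|V|$. It is $3$-uniform if every edge has exactly $3$ elements, and tripartite if $V$ can be partitioned into three sets such that every edge intersects each of the three sets in at most one vertex. A transversal of $\mathcal H$ is a set of vertices intersecting every edge; it is minimal if no proper subset of it is a transversal. $f_3(n)$ denotes the maximum number of minimal transversals of a tripartite $3$-uniform hypergraph of order $n$.
   Formalization: The bound is stated for those positive integers n for which a tripartite 3-uniform hypergraph of order n exists, that is n ≥ 3; since the edges must cover the vertices, f_3(1) and f_3(2) are maxima over an empty set and are undefined. *)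

theory Defs imports Complex_Main begin

definition hypergraph :: "'a set \<Rightarrow> 'a set set \<Rightarrow> bool" where
  "hypergraph V E \<longleftrightarrow> finite V \<and> V = \<Union>E"

definition uniform :: "nat \<Rightarrow> 'a set set \<Rightarrow> bool" where
  "uniform k E \<longleftrightarrow> (\<forall>e\<in>E. card e = k)"

definition tripartite :: "'a set \<Rightarrow> 'a set set \<Rightarrow> bool" where
  "tripartite V E \<longleftrightarrow> (\<exists>A B C. A \<union> B \<union> C = V \<and> A \<inter> B = {} \<and> A \<inter> C = {} \<and> B \<inter> C = {} \<and>
     (\<forall>e\<in>E. card (e \<inter> A) \<le> 1 \<and> card (e \<inter> B) \<le> 1 \<and> card (e \<inter> C) \<le> 1))"

definition transversal :: "'a set \<Rightarrow> 'a set set \<Rightarrow> 'a set \<Rightarrow> bool" where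
  "transversal V E T \<longleftrightarrow> T \<subseteq> V \<and> (\<forall>e\<in>E. T \<inter> e \<noteq> {})"

definition minimal_transversal :: "'a set \<Rightarrow> 'a set set \<Rightarrow> 'a set \<Rightarrow> bool" where
  "minimal_transversal V E T \<longleftrightarrow> transversal V E T \<and> (\<forall>S. S \<subset> T \<longrightarrow> \<not> transversal V E S)"

text \<open>Vertices are taken to be natural numbers; since vertex sets are finite, every hypergraph is
  isomorphic to one of this form.\<close>

definition tripartite_3_uniform :: "nat \<Rightarrow> (nat set \<times> nat set set) set" where
  "tripartite_3_uniform n =
     {(V, E). hypergraph V E \<and> uniform 3 E \<and> tripartite V E \<and> card V = n}"

definition f3 :: "nat \<Rightarrow> nat" where
  "f3 n = Max ((\<lambda>(V, E). card {T. minimal_transversal V E T}) ` tripartite_3_uniform n)"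

text \<open>\<^const>\<open>f3\<close> is a genuine maximum as soon as there is a tripartite 3-uniform hypergraph
  of order \<open>n\<close>. As the edges cover the vertices, there is none of order 1 or 2.\<close>

lemma finite_f3_image:
  "finite ((\<lambda>(V, E). card {T. minimal_transversal V E T}) ` tripartite_3_uniform n)"
proof (rule finite_subset)
  show "(\<lambda>(V, E). card {T. minimal_transversal V E T}) ` tripartite_3_uniform n \<subseteq> {..2 ^ n}"
  proof (clarsimp simp: tripartite_3_uniform_def hypergraph_def)
    fix E :: "nat set set"
    assume "finite (\<Union>E)"
    moreover have "{T. minimal_transversal (\<Union>E) E T} \<subseteq> Pow (\<Union>E)"
      by (auto simp: minimal_transversal_def transversal_def)
    ultimately show "card {T. minimal_transversal (\<Union>E) E T} \<le> 2 ^ card (\<Union>E)"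
      by (metis card_mono card_Pow finite_Pow_iff)
  qed
qed simp

lemma tripartite_3_uniform_nonempty_iff: "tripartite_3_uniform n \<noteq> {} \<longleftrightarrow> n = 0 \<or> n \<ge> 3"
proof
  assume "tripartite_3_uniform n \<noteq> {}"
  then obtain V E where "(V, E) \<in> tripartite_3_uniform n"
    by fastforce
  then have VE: "finite V" "V = \<Union>E" "\<forall>e\<in>E. card e = 3" "card V = n"
    unfolding tripartite_3_uniform_def hypergraph_def uniform_def mem_Collect_eq case_prod_conv
    by blast+
  show "n = 0 \<or> n \<ge> 3"
  proof (cases "E = {}")
    case False
    then obtain e where "e \<in> E" by blast
    then have "e \<subseteq> V" unfolding VE(2) by blast
    then have "card e \<le> card V" using VE(1) by (rule card_mono[rotated])
    then show ?thesis using VE(3,4) \<open>e \<in> E\<close> by simp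
  next
    case True
    then have "V = {}" unfolding VE(2) by simp
    then show ?thesis using VE(4) by simp
  qed
next
  assume "n = 0 \<or> n \<ge> 3"
  then show "tripartite_3_uniform n \<noteq> {}"
  proof
    assume "n = 0"
    then have "({}, {}) \<in> tripartite_3_uniform n"
      by (simp add: tripartite_3_uniform_def hypergraph_def uniform_def tripartite_def)
    then show ?thesis by blast
  next
    assume n: "n \<ge> 3"
    define E :: "nat set set" where "E = (\<lambda>k. {0, 1, k}) ` {2..<n}"
    have "\<Union>E = {..<n}"
    proof
      show "\<Union>E \<subseteq> {..<n}" using n by (auto simp: E_def)
      have "x \<in> \<Union>E" if "x < n" for x
      proof (cases "x < 2")
        case True
        then have "x \<in> {0, 1, 2}" by auto
        moreover have "{0, 1, 2} \<in> E" using n unfolding E_def by (intro image_eqI[of _ _ 2]) auto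
        ultimately show ?thesis by blast
      next
        case False
        then have "{0, 1, x} \<in> E" using that unfolding E_def by (intro image_eqI[of _ _ x]) auto
        then show ?thesis by blast
      qed
      then show "{..<n} \<subseteq> \<Union>E" by blast
    qed
    moreover have "uniform 3 E"
      by (auto simp: uniform_def E_def)
    moreover have "tripartite {..<n} E"
      unfolding tripartite_def
    proof (intro exI conjI ballI)
      show "{0} \<union> {1} \<union> {2..<n} = {..<n}" using n by auto
      fix e assume "e \<in> E"
      then obtain k where k: "e = {0, 1, k}" "2 \<le> k" "k < n" by (auto simp: E_def)
      have "e \<inter> {0} = {0}" "e \<inter> {1} = {1}" "e \<inter> {2..<n} = {k}" using k by auto
      then show "card (e \<inter> {0}) \<le> 1" "card (e \<inter> {1}) \<le> 1" "card (e \<inter> {2..<n}) \<le> 1"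
        by simp_all
    qed auto
    ultimately have "({..<n}, E) \<in> tripartite_3_uniform n"
      by (simp add: tripartite_3_uniform_def hypergraph_def)
    then show ?thesis by blast
  qed
qed

end

theory Submission imports Defs begin

text \<open>
  Minimal transversals of a disjoint union are the unions of minimal transversals of the parts, so
  \<open>f3\<close> is supermultiplicative, and it suffices to find one hypergraph of order \<open>m\<close> with at least
  \<open>1.4977 ^ m\<close> minimal transversals. Take three copies of \<open>\<int>/5\<close> as vertex classes and the 25 triples
  \<open>(i, j, k)\<close> with \<open>i + j + k = 0\<close> as edges. This hypergraph has order 15 and 428 minimal
  transversals, while \<open>1.4977 ^ 15 < 428\<close>. The count is an enumeration: the complement of a minimal
  transversal is a triple \<open>(X, Y, Z)\<close> of subsets of \<open>\<int>/5\<close> in which each set is the complement of the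
  negated sum of the other two, so it is determined by \<open>X\<close> and \<open>Y\<close>.
\<close>

section \<open>Minimal transversals and private edges\<close>

text \<open>If removing v from T leaves an edge unhit, that edge meets T in v alone. Conversely, a
  proper subset of T omits some v and hence misses the private edge of v. Minimality thus becomes a
  condition that can be checked edge by edge.\<close>

lemma minimal_transversal_iff_private_edge:
  "minimal_transversal V E T \<longleftrightarrow>
     transversal V E T \<and> (\<forall>v\<in>T. \<exists>e\<in>E. T \<inter> e = {v})"
proof
  assume min: "minimal_transversal V E T"
  then have T: "transversal V E T" by (simp add: minimal_transversal_def)
  moreover have "\<exists>e\<in>E. T \<inter> e = {v}" if "v \<in> T" for v
  proof -
    have "\<not> transversal V E (T - {v})"
      using min that by (auto simp: minimal_transversal_def)
    then obtain e where "e \<in> E" "(T - {v}) \<inter> e = {}"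
      using T by (auto simp: transversal_def)
    moreover from this have "T \<inter> e \<noteq> {}" using T by (auto simp: transversal_def)
    ultimately show ?thesis by (intro bexI[of _ e]) auto
  qed
  ultimately show "transversal V E T \<and> (\<forall>v\<in>T. \<exists>e\<in>E. T \<inter> e = {v})" by blast
next
  assume T: "transversal V E T \<and> (\<forall>v\<in>T. \<exists>e\<in>E. T \<inter> e = {v})"
  have "\<not> transversal V E S" if "S \<subset> T" for S
  proof -
    obtain v where v: "v \<in> T" "v \<notin> S" using \<open>S \<subset> T\<close> by blast
    then obtain e where "e \<in> E" "T \<inter> e = {v}" using T by blast
    then have "S \<inter> e = {}" using v psubset_imp_subset[OF \<open>S \<subset> T\<close>] by auto
    then show ?thesis using \<open>e \<in> E\<close> by (auto simp: transversal_def)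
  qed
  then show "minimal_transversal V E T" using T by (simp add: minimal_transversal_def)
qed

lemma minimal_transversal_subset: "minimal_transversal V E T \<Longrightarrow> T \<subseteq> V"
  by (simp add: minimal_transversal_def transversal_def)

lemma finite_minimal_transversals:
  assumes "finite V"
  shows "finite {T. minimal_transversal V E T}"
  by (rule finite_subset[of _ "Pow V"]) (use assms minimal_transversal_subset in auto)

lemma exists_minimal_transversal:
  assumes "finite V" "transversal V E V"
  shows "\<exists>T. minimal_transversal V E T"
proof -
  have "finite {T. transversal V E T}"
    by (rule finite_subset[of _ "Pow V"]) (use assms in \<open>auto simp: transversal_def\<close>)
  then obtain T where "transversal V E T" "\<forall>S. transversal V E S \<longrightarrow> S \<subseteq> T \<longrightarrow> T = S"
    using finite_has_minimal[of "{T. transversal V E T}"] assms(2) by auto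
  then show ?thesis by (auto simp: minimal_transversal_def)
qed

lemma minimal_transversal_image:
  assumes "inj f" "minimal_transversal V E T"
  shows "minimal_transversal (f ` V) ((`) f ` E) (f ` T)"
proof -
  have Int: "f ` T \<inter> f ` e = f ` (T \<inter> e)" for e
    using assms(1) by (simp add: image_Int)
  have T: "transversal V E T" "\<forall>v\<in>T. \<exists>e\<in>E. T \<inter> e = {v}"
    using assms(2) by (simp_all add: minimal_transversal_iff_private_edge)
  have "\<exists>e\<in>E. f ` T \<inter> f ` e = {f v}" if v: "v \<in> T" for v
  proof -
    obtain e where e: "e \<in> E" "T \<inter> e = {v}" using bspec[OF T(2) v] ..
    have "f ` T \<inter> f ` e = {f v}" unfolding Int e(2) by simp
    then show ?thesis using e(1) ..
  qed
  moreover have "transversal (f ` V) ((`) f ` E) (f ` T)"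
    using T(1) by (simp add: transversal_def Int image_mono)
  ultimately show ?thesis by (simp add: minimal_transversal_iff_private_edge)
qed

text \<open>An edge of one part meets \<open>S \<union> T\<close> only in the half belonging to that
  part, so it is hit, or private to a vertex, exactly as before.\<close>

lemma minimal_transversal_Un:
  assumes "V \<inter> W = {}" "\<Union>E \<subseteq> V" "\<Union>F \<subseteq> W"
    and "minimal_transversal V E S" "minimal_transversal W F T"
  shows "minimal_transversal (V \<union> W) (E \<union> F) (S \<union> T)"
proof -
  have sub: "S \<subseteq> V" "T \<subseteq> W"
    using assms(4,5) by (auto dest: minimal_transversal_subset)
  have E: "(S \<union> T) \<inter> e = S \<inter> e" if "e \<in> E" for e
    using that sub assms(1-3) by blast
  have F: "(S \<union> T) \<inter> e = T \<inter> e" if "e \<in> F" for e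
    using that sub assms(1-3) by blast
  have S: "transversal V E S" "\<forall>v\<in>S. \<exists>e\<in>E. S \<inter> e = {v}"
    and T: "transversal W F T" "\<forall>v\<in>T. \<exists>e\<in>F. T \<inter> e = {v}"
    using assms(4,5) by (simp_all add: minimal_transversal_iff_private_edge)
  have "transversal (V \<union> W) (E \<union> F) (S \<union> T)"
    using S(1) T(1) sub by (simp add: transversal_def ball_Un E F le_supI1 le_supI2)
  moreover have "\<forall>v\<in>S \<union> T. \<exists>e\<in>E \<union> F. (S \<union> T) \<inter> e = {v}"
    using S(2) T(2) by (simp add: ball_Un bex_Un E F cong: bex_cong)
  ultimately show ?thesis by (simp add: minimal_transversal_iff_private_edge)
qed

section \<open>Supermultiplicativity\<close>

lemma card_minimal_transversals_le_f3:
  assumes "(V, E) \<in> tripartite_3_uniform n"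
  shows "card {T. minimal_transversal V E T} \<le> f3 n"
  unfolding f3_def by (rule Max_ge[OF finite_f3_image]) (use assms in force)

lemma f3_attained:
  assumes "tripartite_3_uniform n \<noteq> {}"
  obtains V E where "(V, E) \<in> tripartite_3_uniform n" "f3 n = card {T. minimal_transversal V E T}"
  using Max_in[OF finite_f3_image, of n] assms unfolding f3_def[symmetric] by auto

text \<open>This is the base case for adjoining blocks. Edges of size 3 are nonempty, so the whole
  vertex set is a transversal, and it contains a minimal one.\<close>

lemma f3_pos:
  assumes "tripartite_3_uniform n \<noteq> {}"
  shows "f3 n > 0"
proof -
  obtain V E where VE: "(V, E) \<in> tripartite_3_uniform n"
    and f3: "f3 n = card {T. minimal_transversal V E T}"
    using f3_attained[OF assms] .
  have V: "finite V" "V = \<Union>E" "\<forall>e\<in>E. card e = 3"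
    using VE unfolding tripartite_3_uniform_def hypergraph_def uniform_def mem_Collect_eq case_prod_conv
    by blast+
  have "transversal V E V"
    unfolding transversal_def
  proof (intro conjI ballI subset_refl)
    fix e assume "e \<in> E"
    then have "e \<noteq> {}" "e \<subseteq> V" using V(2,3) by force+
    then show "V \<inter> e \<noteq> {}" by blast
  qed
  then have "{T. minimal_transversal V E T} \<noteq> {}"
    using exists_minimal_transversal[OF V(1)] by blast
  then show ?thesis
    unfolding f3 using finite_minimal_transversals[OF V(1)] by (simp add: card_gt_0_iff)
qed

lemma tripartite_3_uniform_image:
  assumes "inj f" "(V, E) \<in> tripartite_3_uniform n"
  shows "(f ` V, (`) f ` E) \<in> tripartite_3_uniform n"
proof -
  have VE: "hypergraph V E" "uniform 3 E" "tripartite V E" "card V = n"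
    using assms(2) by (auto simp: tripartite_3_uniform_def)
  have card: "card (f ` X) = card X" for X
    using assms(1) by (intro card_image) (auto intro: inj_on_subset)
  have Int: "f ` X \<inter> f ` Y = f ` (X \<inter> Y)" for X Y
    using assms(1) by (simp add: image_Int)
  obtain A B C where ABC: "A \<union> B \<union> C = V" "A \<inter> B = {}" "A \<inter> C = {}" "B \<inter> C = {}"
    "\<forall>e\<in>E. card (e \<inter> A) \<le> 1 \<and> card (e \<inter> B) \<le> 1 \<and> card (e \<inter> C) \<le> 1"
    using VE(3) unfolding tripartite_def by blast
  have "tripartite (f ` V) ((`) f ` E)"
    unfolding tripartite_def
    by (rule exI[of _ "f ` A"], rule exI[of _ "f ` B"], rule exI[of _ "f ` C"])
      (use ABC in \<open>simp add: Int card image_Un[symmetric]\<close>)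
  moreover have "hypergraph (f ` V) ((`) f ` E)"
    using VE(1) by (auto simp: hypergraph_def)
  ultimately show ?thesis
    using VE by (simp add: tripartite_3_uniform_def uniform_def card)
qed

text \<open>Corresponding classes are merged; an edge sees only the half of a merged class that
  comes from its own hypergraph.\<close>

lemma tripartite_3_uniform_Un:
  assumes "(V, E) \<in> tripartite_3_uniform m" "(W, F) \<in> tripartite_3_uniform n" "V \<inter> W = {}"
  shows "(V \<union> W, E \<union> F) \<in> tripartite_3_uniform (m + n)"
proof -
  have VE: "hypergraph V E" "uniform 3 E" "tripartite V E" "card V = m"
    and WF: "hypergraph W F" "uniform 3 F" "tripartite W F" "card W = n"
    using assms(1,2) by (auto simp: tripartite_3_uniform_def)
  obtain A B C where ABC: "A \<union> B \<union> C = V" "A \<inter> B = {}" "A \<inter> C = {}" "B \<inter> C = {}"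
    "\<forall>e\<in>E. card (e \<inter> A) \<le> 1 \<and> card (e \<inter> B) \<le> 1 \<and> card (e \<inter> C) \<le> 1"
    using VE(3) unfolding tripartite_def by blast
  obtain A' B' C' where ABC': "A' \<union> B' \<union> C' = W" "A' \<inter> B' = {}" "A' \<inter> C' = {}" "B' \<inter> C' = {}"
    "\<forall>e\<in>F. card (e \<inter> A') \<le> 1 \<and> card (e \<inter> B') \<le> 1 \<and> card (e \<inter> C') \<le> 1"
    using WF(3) unfolding tripartite_def by blast
  have E: "e \<inter> (X \<union> X') = e \<inter> X" if "e \<in> E" "X' \<subseteq> W" for e X X'
    using that VE(1) assms(3) unfolding hypergraph_def by blast
  have F: "e \<inter> (X \<union> X') = e \<inter> X'" if "e \<in> F" "X \<subseteq> V" for e X X'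
    using that WF(1) assms(3) unfolding hypergraph_def by blast
  have sub: "A \<subseteq> V" "B \<subseteq> V" "C \<subseteq> V" "A' \<subseteq> W" "B' \<subseteq> W" "C' \<subseteq> W"
    using ABC(1) ABC'(1) by blast+
  have "tripartite (V \<union> W) (E \<union> F)"
    unfolding tripartite_def
  proof (rule exI[of _ "A \<union> A'"], rule exI[of _ "B \<union> B'"], rule exI[of _ "C \<union> C'"], intro conjI)
    show "A \<union> A' \<union> (B \<union> B') \<union> (C \<union> C') = V \<union> W" using ABC(1) ABC'(1) by blast
    show "(A \<union> A') \<inter> (B \<union> B') = {}" "(A \<union> A') \<inter> (C \<union> C') = {}" "(B \<union> B') \<inter> (C \<union> C') = {}"
      using ABC(2-4) ABC'(2-4) sub assms(3) by blast+
    show "\<forall>e\<in>E \<union> F. card (e \<inter> (A \<union> A')) \<le> 1 \<and> card (e \<inter> (B \<union> B')) \<le> 1 \<and> card (e \<inter> (C \<union> C')) \<le> 1"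
      using ABC(5) ABC'(5) sub by (simp add: ball_Un E F)
  qed
  moreover have "card (V \<union> W) = m + n"
    using card_Un_disjoint[OF _ _ assms(3)] VE(1,4) WF(1,4) unfolding hypergraph_def by metis
  ultimately show ?thesis
    using VE(1,2) WF(1,2) by (auto simp: tripartite_3_uniform_def hypergraph_def uniform_def)
qed

text \<open>Place two extremal hypergraphs side by side. Intersecting \<open>S \<union> T\<close>
  with \<open>V\<close> and \<open>W\<close> recovers \<open>S\<close> and \<open>T\<close>, so
  distinct pairs give distinct minimal transversals of the union.\<close>

lemma f3_supermultiplicative:
  assumes "tripartite_3_uniform m \<noteq> {}" "tripartite_3_uniform n \<noteq> {}"
  shows "f3 m * f3 n \<le> f3 (m + n)"
proof -
  obtain V E where VE: "(V, E) \<in> tripartite_3_uniform m"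
    and f3m: "f3 m = card {T. minimal_transversal V E T}"
    using f3_attained[OF assms(1)] .
  obtain W0 F0 where WF0: "(W0, F0) \<in> tripartite_3_uniform n"
    and f3n: "f3 n = card {T. minimal_transversal W0 F0 T}"
    using f3_attained[OF assms(2)] .
  have V: "finite V" "\<Union>E \<subseteq> V"
    using VE by (auto simp: tripartite_3_uniform_def hypergraph_def)
  \<comment> \<open>The two extremal hypergraphs may share vertices. Translating the second by a
    strict upper bound of \<open>V\<close> makes them disjoint.\<close>
  then obtain k where k: "\<forall>v\<in>V. v < k"
    using finite_nat_set_iff_bounded by blast
  let ?f = "(+) k"
  define W where "W = ?f ` W0"
  define F where "F = (`) ?f ` F0"
  have inj: "inj ?f" by simp
  have WF: "(W, F) \<in> tripartite_3_uniform n"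
    unfolding W_def F_def by (rule tripartite_3_uniform_image[OF inj WF0])
  then have W: "finite W" "\<Union>F \<subseteq> W"
    by (auto simp: tripartite_3_uniform_def hypergraph_def)
  have disj: "V \<inter> W = {}" using k by (auto simp: W_def)
  let ?M = "{T. minimal_transversal V E T}"
  let ?N = "{T. minimal_transversal W F T}"
  let ?U = "{T. minimal_transversal (V \<union> W) (E \<union> F) T}"
  have "f3 n \<le> card ?N"
    unfolding f3n
  proof (rule card_inj_on_le[of "(`) ?f"])
    show "inj_on ((`) ?f) {T. minimal_transversal W0 F0 T}"
      using inj by (auto simp: inj_on_def inj_image_eq_iff)
    show "(`) ?f ` {T. minimal_transversal W0 F0 T} \<subseteq> ?N"
      using minimal_transversal_image[OF inj] by (auto simp: W_def F_def)
    show "finite ?N" by (rule finite_minimal_transversals[OF W(1)])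
  qed
  then have "f3 m * f3 n \<le> card (?M \<times> ?N)"
    by (simp add: f3m card_cartesian_product)
  also have "\<dots> \<le> card ?U"
  proof (rule card_inj_on_le[of "\<lambda>(S, T). S \<union> T"])
    have inj: "S = S' \<and> T = T'"
      if "S \<union> T = S' \<union> T'" "S \<subseteq> V" "S' \<subseteq> V" "T \<subseteq> W" "T' \<subseteq> W" for S S' T T'
      using that disj by blast
    show "inj_on (\<lambda>(S, T). S \<union> T) (?M \<times> ?N)"
    proof (rule inj_onI)
      fix p p' assume "p \<in> ?M \<times> ?N" "p' \<in> ?M \<times> ?N"
        and eq: "(\<lambda>(S, T). S \<union> T) p = (\<lambda>(S, T). S \<union> T) p'"
      then have "fst p \<subseteq> V" "fst p' \<subseteq> V" "snd p \<subseteq> W" "snd p' \<subseteq> W"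
        by (auto simp only: mem_Times_iff mem_Collect_eq dest!: minimal_transversal_subset)
      then show "p = p'"
        using inj[of "fst p" "snd p" "fst p'" "snd p'"] eq by (simp add: split_beta prod_eq_iff)
    qed
    show "(\<lambda>(S, T). S \<union> T) ` (?M \<times> ?N) \<subseteq> ?U"
      using minimal_transversal_Un[OF disj V(2) W(2)] by auto
    show "finite ?U" using V(1) W(1) by (simp add: finite_minimal_transversals)
  qed
  also have "\<dots> \<le> f3 (m + n)"
    by (rule card_minimal_transversals_le_f3[OF tripartite_3_uniform_Un[OF VE WF disj]])
  finally show ?thesis .
qed

section \<open>Zero-sum triples in the cyclic group of order 5\<close>

text \<open>The edges form the Latin square of addition modulo 5: two vertices of different classes
  lie in exactly one edge. The offsets 5 and 10 keep the three copies of the group apart.\<close>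

definition zero_sum_edges :: "nat set set" where
  "zero_sum_edges = {{i, 5 + j, 10 + k} | i j k. i < 5 \<and> j < 5 \<and> k < 5 \<and> 5 dvd i + j + k}"

lemma zero_sum_edgesI:
  "i < 5 \<Longrightarrow> j < 5 \<Longrightarrow> k < 5 \<Longrightarrow> 5 dvd i + j + k \<Longrightarrow> {i, 5 + j, 10 + k} \<in> zero_sum_edges"
  unfolding zero_sum_edges_def by blast

lemma zero_sum_edges_tripartite_3_uniform: "({..<15}, zero_sum_edges) \<in> tripartite_3_uniform 15"
proof -
  have "\<Union>zero_sum_edges = {..<15}"
  proof
    show "\<Union>zero_sum_edges \<subseteq> {..<15}"
      by (auto simp: zero_sum_edges_def)
    have "v \<in> \<Union>zero_sum_edges" if "v < 15" for v
    proof -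
      consider "v < 5" | "5 \<le> v" "v < 10" | "10 \<le> v" by linarith
      then show ?thesis
      proof cases
        case 1
        \<comment> \<open>A covering edge uses the residue of v, its negative and 0. The case
          distinction is there because \<open>5 - v\<close> is not a reduced residue when v is
          0.\<close>
        then have "{v, 5 + (if v = 0 then 0 else 5 - v), 10 + 0} \<in> zero_sum_edges"
          by (intro zero_sum_edgesI) auto
        then show ?thesis by blast
      next
        case 2
        then have "{if v = 5 then 0 else 10 - v, 5 + (v - 5), 10 + 0} \<in> zero_sum_edges"
          by (intro zero_sum_edgesI) auto
        moreover have "5 + (v - 5) = v" using 2 by simp
        ultimately show ?thesis by (metis UnionI insertCI)
      next
        case 3
        then have "{if v = 10 then 0 else 15 - v, 5 + 0, 10 + (v - 10)} \<in> zero_sum_edges"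
          using \<open>v < 15\<close> by (intro zero_sum_edgesI) auto
        moreover have "10 + (v - 10) = v" using 3 by simp
        ultimately show ?thesis by (metis UnionI insertCI)
      qed
    qed
    then show "{..<15} \<subseteq> \<Union>zero_sum_edges" by blast
  qed
  moreover have "uniform 3 zero_sum_edges"
    by (auto simp: uniform_def zero_sum_edges_def)
  moreover have "tripartite {..<15} zero_sum_edges"
    unfolding tripartite_def
  proof (intro exI conjI ballI)
    show "{..<5} \<union> {5..<10} \<union> {10..<15} = {..<15::nat}" by auto
    fix e assume "e \<in> zero_sum_edges"
    then obtain i j k where e: "e = {i, 5 + j, 10 + k}" "i < 5" "j < 5" "k < 5"
      by (auto simp: zero_sum_edges_def)
    have "e \<inter> {..<5} = {i}" "e \<inter> {5..<10} = {5 + j}" "e \<inter> {10..<15} = {10 + k}"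
      using e by auto
    then show "card (e \<inter> {..<5}) \<le> 1" "card (e \<inter> {5..<10}) \<le> 1" "card (e \<inter> {10..<15}) \<le> 1"
      by simp_all
  qed auto
  ultimately show ?thesis
    by (simp add: tripartite_3_uniform_def hypergraph_def)
qed

text \<open>Subsets of \<open>\<int>/5\<close> are encoded as characteristic vectors; \<open>neg_sum xs ys\<close> encodes \<open>-(X + Y)\<close>,
  since entry \<open>i\<close> of \<open>rotate (k + 4) (rev ys)\<close> is entry \<open>-i - k\<close> of \<open>ys\<close>.\<close>

definition neg_sum :: "bool list \<Rightarrow> bool list \<Rightarrow> bool list" where
  "neg_sum xs ys = map (\<lambda>k. list_ex (\<lambda>(a, b). a \<and> b) (zip xs (rotate (k + 4) (rev ys)))) [0..<5]"

lemma nth_neg_sum: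
  assumes "length xs = 5" "length ys = 5" "k < 5"
  shows "neg_sum xs ys ! k \<longleftrightarrow> (\<exists>i<5. \<exists>j<5. xs ! i \<and> ys ! j \<and> 5 dvd i + j + k)"
proof -
  \<comment> \<open>Unfolding \<open>rotate\<close> and then \<open>rev\<close> produces the index
    on the right. It is the residue of -(i + k), hence the unique j completing i and k to a zero
    sum.\<close>
  have *: "j < 5 \<and> 5 dvd i + j + k \<longleftrightarrow> j = 4 - (k + 4 + i) mod 5" if "i < 5" for i j
  proof -
    have "i \<in> {0,1,2,3,4}" "k \<in> {0,1,2,3,4}" using that assms(3) by auto
    then show ?thesis by (auto; presburger)
  qed
  have "neg_sum xs ys ! k \<longleftrightarrow> (\<exists>i<5. xs ! i \<and> ys ! (4 - (k + 4 + i) mod 5))"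
    using assms by (auto simp: neg_sum_def list_ex_length nth_rotate rev_nth)
  also have "\<dots> \<longleftrightarrow> (\<exists>i<5. \<exists>j. xs ! i \<and> ys ! j \<and> (j < 5 \<and> 5 dvd i + j + k))"
    using * by (metis (no_types, lifting))
  finally show ?thesis by blast
qed

text \<open>For fixed X and Y this is the largest Z such that X, Y, Z contain no zero-sum
  triple.\<close>

definition third :: "bool list \<Rightarrow> bool list \<Rightarrow> bool list" where
  "third xs ys = map Not (neg_sum xs ys)"

lemma length_third: "length (third xs ys) = 5"
  by (simp add: third_def neg_sum_def)

lemma nth_third:
  assumes "length xs = 5" "length ys = 5" "k < 5"
  shows "third xs ys ! k \<longleftrightarrow> \<not> (\<exists>i<5. \<exists>j<5. xs ! i \<and> ys ! j \<and> 5 dvd i + j + k)"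
proof -
  have "third xs ys ! k \<longleftrightarrow> \<not> neg_sum xs ys ! k"
    using assms(3) by (simp add: third_def neg_sum_def)
  then show ?thesis unfolding nth_neg_sum[OF assms] .
qed

section \<open>Enumeration of the maximal zero-sum-free triples\<close>

text \<open>With \<open>zs\<close> as the third set, the two equations say that X and Y cannot be
  enlarged either, so (X, Y, Z) is a maximal independent set of the hypergraph.\<close>

definition maximal_pair :: "bool list \<Rightarrow> bool list \<Rightarrow> bool" where
  "maximal_pair xs ys \<longleftrightarrow> (let zs = third xs ys in third ys zs = xs \<and> third xs zs = ys)"

definition maximal_pairs :: "(bool list \<times> bool list) list" where
  "maximal_pairs = (let L = List.n_lists 5 [False, True] in
     filter (\<lambda>(xs, ys). maximal_pair xs ys) (List.product L L))"

text \<open>It lets the evaluation of the count proceed row by row instead of building the list of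
  all 1024 pairs.\<close>

lemma length_filter_product:
  "length (filter (\<lambda>(x, y). P x y) (List.product xs ys)) = (\<Sum>x\<leftarrow>xs. length (filter (P x) ys))"
  by (induction xs) (simp_all add: filter_map comp_def)

lemma length_maximal_pairs: "length maximal_pairs = 428"
  unfolding maximal_pairs_def Let_def length_filter_product by code_simp

text \<open>\<open>complement\<close> is taken in the vertex set \<open>{..<15}\<close>, whose classes are shifted by 0, 5 and 10.\<close>

definition complement :: "bool list \<Rightarrow> bool list \<Rightarrow> bool list \<Rightarrow> nat set" where
  "complement xs ys zs =
     {i. i < 5 \<and> \<not> xs ! i} \<union> (+) 5 ` {j. j < 5 \<and> \<not> ys ! j} \<union> (+) 10 ` {k. k < 5 \<and> \<not> zs ! k}"

lemma mem_complement:
  assumes "i < 5"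
  shows "i \<in> complement xs ys zs \<longleftrightarrow> \<not> xs ! i"
    and "5 + i \<in> complement xs ys zs \<longleftrightarrow> \<not> ys ! i"
    and "10 + i \<in> complement xs ys zs \<longleftrightarrow> \<not> zs ! i"
  using assms by (auto simp: complement_def)

text \<open>Since Z avoids -(X + Y), no edge lies inside the triple, so its complement hits every
  edge. A vertex outside its own set is, by the equation for that set, completed to a zero sum by
  elements of the other two; that edge is private to it.\<close>

lemma minimal_transversal_complement:
  assumes len: "length xs = 5" "length ys = 5" "length zs = 5"
    and third: "third xs ys = zs" "third ys zs = xs" "third xs zs = ys"
  shows "minimal_transversal {..<15} zero_sum_edges (complement xs ys zs)"
  unfolding minimal_transversal_iff_private_edge
proof
  let ?T = "complement xs ys zs"
  have zs: "zs ! k \<longleftrightarrow> \<not> (\<exists>i<5. \<exists>j<5. xs ! i \<and> ys ! j \<and> 5 dvd i + j + k)" if "k < 5" for k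
    using nth_third[OF len(1,2) that] by (simp add: third)
  have xs: "xs ! i \<longleftrightarrow> \<not> (\<exists>j<5. \<exists>k<5. ys ! j \<and> zs ! k \<and> 5 dvd j + k + i)" if "i < 5" for i
    using nth_third[OF len(2,3) that] by (simp add: third)
  have ys: "ys ! j \<longleftrightarrow> \<not> (\<exists>i<5. \<exists>k<5. xs ! i \<and> zs ! k \<and> 5 dvd i + k + j)" if "j < 5" for j
    using nth_third[OF len(1,3) that] by (simp add: third)
  have "?T \<inter> {i, 5 + j, 10 + k} \<noteq> {}" if "i < 5" "j < 5" "k < 5" "5 dvd i + j + k" for i j k
  proof -
    have "\<not> (xs ! i \<and> ys ! j \<and> zs ! k)" using zs[OF that(3)] that by blast
    then have "i \<in> ?T \<or> 5 + j \<in> ?T \<or> 10 + k \<in> ?T"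
      using that by (simp add: mem_complement)
    then show ?thesis by blast
  qed
  moreover have "?T \<subseteq> {..<15}" by (auto simp: complement_def)
  ultimately show "transversal {..<15} zero_sum_edges ?T"
    unfolding transversal_def zero_sum_edges_def by blast
  show "\<forall>v\<in>?T. \<exists>e\<in>zero_sum_edges. ?T \<inter> e = {v}"
  proof
    fix v assume v: "v \<in> ?T"
    have "\<exists>i<5. \<exists>j<5. \<exists>k<5. 5 dvd i + j + k \<and> ?T \<inter> {i, 5 + j, 10 + k} = {v}"
    proof -
      consider (1) "v < 5" "\<not> xs ! v" | (2) j where "v = 5 + j" "j < 5" "\<not> ys ! j"
        | (3) k where "v = 10 + k" "k < 5" "\<not> zs ! k"
        using v by (auto simp: complement_def)
      then show ?thesis
      proof cases
        case 1
        then obtain j k where jk: "j < 5" "k < 5" "ys ! j" "zs ! k" "5 dvd j + k + v"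
          using xs by blast
        then have "5 + j \<notin> ?T" "10 + k \<notin> ?T" by (simp_all add: mem_complement)
        then have "?T \<inter> {v, 5 + j, 10 + k} = {v}" using v by blast
        moreover have "5 dvd v + j + k" using jk(5) by (simp add: add_ac)
        ultimately show ?thesis using 1 jk by blast
      next
        case 2
        then obtain i k where ik: "i < 5" "k < 5" "xs ! i" "zs ! k" "5 dvd i + k + j"
          using ys by blast
        then have "i \<notin> ?T" "10 + k \<notin> ?T" by (simp_all add: mem_complement)
        then have "?T \<inter> {i, 5 + j, 10 + k} = {v}" using v 2(1) by blast
        moreover have "5 dvd i + j + k" using ik(5) by (simp add: add_ac)
        ultimately show ?thesis using 2 ik by blast
      next
        case 3
        then obtain i j where ij: "i < 5" "j < 5" "xs ! i" "ys ! j" "5 dvd i + j + k"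
          using zs by blast
        then have "i \<notin> ?T" "5 + j \<notin> ?T" by (simp_all add: mem_complement)
        then have "?T \<inter> {i, 5 + j, 10 + k} = {v}" using v 3(1) by blast
        then show ?thesis using 3 ij by blast
      qed
    qed
    then show "\<exists>e\<in>zero_sum_edges. ?T \<inter> e = {v}" using zero_sum_edgesI by blast
  qed
qed

text \<open>Membership in the complement determines every entry of \<open>xs\<close> and
  \<open>ys\<close>, so the enumerated pairs yield pairwise distinct minimal transversals.\<close>

lemma f3_15_ge: "f3 15 \<ge> 428"
proof -
  let ?F = "\<lambda>(xs, ys). complement xs ys (third xs ys)"
  have maximal: "length xs = 5 \<and> length ys = 5 \<and>
      third ys (third xs ys) = xs \<and> third xs (third xs ys) = ys"
    if "(xs, ys) \<in> set maximal_pairs" for xs ys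
    using that by (auto simp: maximal_pairs_def maximal_pair_def Let_def length_n_lists_elem)
  have "distinct maximal_pairs"
    unfolding maximal_pairs_def Let_def
    by (intro distinct_filter distinct_product distinct_n_lists) simp_all
  then have "428 = card (set maximal_pairs)"
    by (simp add: distinct_card length_maximal_pairs)
  also have "\<dots> \<le> card {T. minimal_transversal {..<15} zero_sum_edges T}"
  proof (rule card_inj_on_le[of ?F])
    have inj: "xs = xs' \<and> ys = ys'"
      if pairs: "(xs, ys) \<in> set maximal_pairs" "(xs', ys') \<in> set maximal_pairs"
        and eq: "complement xs ys zs = complement xs' ys' zs'" for xs ys zs xs' ys' zs'
    proof -
      have "xs ! i = xs' ! i" "ys ! i = ys' ! i" if "i < 5" for i
        using mem_complement[OF that, of xs ys zs] mem_complement[OF that, of xs' ys' zs'] eq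
        by simp_all
      moreover have "length xs = 5" "length ys = 5" "length xs' = 5" "length ys' = 5"
        using maximal pairs by blast+
      ultimately show ?thesis by (simp add: list_eq_iff_nth_eq)
    qed
    show "inj_on ?F (set maximal_pairs)"
    proof (rule inj_onI)
      fix p p' assume "p \<in> set maximal_pairs" "p' \<in> set maximal_pairs" "?F p = ?F p'"
      then show "p = p'"
        using inj[of "fst p" "snd p" "fst p'" "snd p'"] by (simp add: split_beta prod_eq_iff)
    qed
    show "?F ` set maximal_pairs \<subseteq> {T. minimal_transversal {..<15} zero_sum_edges T}"
    proof (rule image_subsetI)
      fix p assume p: "p \<in> set maximal_pairs"
      obtain xs ys where "p = (xs, ys)" by fastforce
      then show "?F p \<in> {T. minimal_transversal {..<15} zero_sum_edges T}"
        using maximal[of xs ys] p by (simp add: minimal_transversal_complement length_third)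
    qed
    show "finite {T. minimal_transversal {..<15} zero_sum_edges T}"
      by (simp add: finite_minimal_transversals)
  qed
  also have "\<dots> \<le> f3 15"
    by (rule card_minimal_transversals_le_f3[OF zero_sum_edges_tripartite_3_uniform])
  finally show ?thesis .
qed

section \<open>Exponential lower bound for all orders\<close>

text \<open>Start from a hypergraph of order s, which has at least one minimal transversal; each
  further block of order 15 multiplies the count by at least 428.\<close>

lemma f3_add_15_mult:
  assumes "tripartite_3_uniform s \<noteq> {}"
  shows "428 ^ q \<le> f3 (15 * q + s)"
proof (induction q)
  case 0
  then show ?case using f3_pos[OF assms] by simp
next
  case (Suc q)
  have "tripartite_3_uniform 15 \<noteq> {}" "tripartite_3_uniform (15 * q + s) \<noteq> {}"
    using assms by (auto simp: tripartite_3_uniform_nonempty_iff)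
  note super = f3_supermultiplicative[OF this]
  have "428 ^ Suc q \<le> f3 15 * f3 (15 * q + s)"
    unfolding power_Suc using f3_15_ge Suc.IH by (rule mult_le_mono)
  also note super
  also have "15 + (15 * q + s) = 15 * Suc q + s" by simp
  finally show ?case .
qed

text \<open>The blocks of order 15 supply growth rate r. The remaining s vertices are credited with
  only a factor 1 instead of \<open>r ^ s\<close>, and the constant \<open>1 / r ^ 17\<close>
  absorbs this loss because s is at most 17.\<close>

lemma f3_exponential_lower_bound:
  fixes r :: real
  assumes r: "r \<ge> 1" "r ^ 15 \<le> 428" and "n \<ge> 3"
  shows "1 / r ^ 17 * r ^ n \<le> real (f3 n)"
proof -
  \<comment> \<open>Orders 1 and 2 are impossible, so the remainder modulo 15 is taken in \<open>{3..17}\<close>.\<close>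
  have "\<exists>q t. n - 3 = 15 * q + t \<and> t < 15"
    by (metis mult_div_mod_eq mod_less_divisor zero_less_numeral)
  then obtain q t where t: "n - 3 = 15 * q + t" "t < 15" by blast
  define s where "s = t + 3"
  have n: "n = 15 * q + s" and s: "3 \<le> s" "s \<le> 17"
    using t \<open>n \<ge> 3\<close> by (simp_all add: s_def)
  have "(r ^ 15) ^ q \<le> 428 ^ q" using r by (intro power_mono) simp_all
  moreover have "r ^ s \<le> r ^ 17" using s r by (intro power_increasing) simp_all
  ultimately have "r ^ n \<le> 428 ^ q * r ^ 17"
    unfolding n power_add power_mult using r by (intro mult_mono) simp_all
  then have "1 / r ^ 17 * r ^ n \<le> 428 ^ q"
    using r by (simp add: field_simps)
  moreover have "428 ^ q \<le> f3 n"
    unfolding n using s by (intro f3_add_15_mult) (simp add: tripartite_3_uniform_nonempty_iff)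
  then have "428 ^ q \<le> real (f3 n)"
    by (metis of_nat_le_iff of_nat_numeral of_nat_power)
  ultimately show ?thesis by (rule order_trans)
qed

theorem theorem1:
  "\<exists>c::real. c > 0 \<and> (\<forall>n::nat. n > 0 \<longrightarrow> tripartite_3_uniform n \<noteq> {} \<longrightarrow>
     real (f3 n) \<ge> c * 1.4977 ^ n)"
proof (rule exI[of _ "1 / 1.4977 ^ 17"], rule conjI)
  show "0 < 1 / (1.4977::real) ^ 17" by simp
  show "\<forall>n>0. tripartite_3_uniform n \<noteq> {} \<longrightarrow> 1 / 1.4977 ^ 17 * 1.4977 ^ n \<le> real (f3 n)"
  proof (intro allI impI, rule f3_exponential_lower_bound)
    show "1 \<le> (1.4977::real)" by simp
    \<comment> \<open>1.4977 is the 15th root of 428 truncated to four decimals.\<close>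
    show "(1.4977::real) ^ 15 \<le> 428" by (simp add: power_divide)
    \<comment> \<open>At orders 1 and 2, \<open>f3\<close> would be the \<open>Max\<close> of an
      empty set; the nonemptiness hypothesis excludes them.\<close>
    show "n \<ge> 3" if "n > 0" "tripartite_3_uniform n \<noteq> {}" for n
      using that by (simp add: tripartite_3_uniform_nonempty_iff)
  qed
qed

end
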